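(* Let $\{p_i,\rho_i\}_{i=1}^m$ be an ensemble of $m$ linearly independent states on the $n$-dimensional Hilbert space $\mathcal{H}$ whose supports together span $\mathcal{H}$. An $m$-element POVM $\{\Pi_i\}_{i=1}^m$ on $\mathcal{H}$ is optimal for minimum error discrimination of $\{p_i,\rho_i\}_{i=1}^m$ if and only if $\{\Pi_i\}_{i=1}^m$ is a projective measurement and $\sum_{i=1}^m p_i\rho_i\Pi_i>0$ (i.e. this operator is Hermitian positive definite).
   Context: Linearly independent ensemble: $p_i>0$, $\sum_i p_i=1$, the $\rho_i$ are density operators on the finite-dimensional complex Hilbert space $\mathcal{H}$, and the supports $\mathrm{supp}(\rho_1),\dots,\mathrm{supp}(\rho_m)$ are linearly independent subspaces which together span $\mathcal{H}$, so $\sum_i\mathrm{rank}(\rho_i)=n=\dim\mathcal{H}$. An $m$-element POVM is a family $\{\Pi_i\}_{i=1}^m$ with $\Pi_i\ge0$ and $\sum_i\Pi_i=\mathbb{1}$; it is a projective measurement if $\Pi_i\Pi_j=\delta_{ij}\Pi_i$ for all $i,j$. It is optimal for minimum error discrimination (MED) of $\{p_i,\rho_i\}$ if it maximizes $P_s=\sum_i p_i\mathrm{Tr}(\rho_i\Pi_i)$ over all $m$-element POVMs. *)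

theory Defs
  imports "HOL-Analysis.Analysis"
begin

text \<open>
  The Hilbert space is \<open>complex ^ 'n\<close>, operators on it are matrices \<open>complex ^ 'n ^ 'n\<close>.
  The library's inner product and \<open>adjoint\<close> on this type are those of the underlying real
  space, so the Hermitian versions are introduced here. Families are functions on \<open>nat\<close> of which
  only the members with index in \<open>{1..m}\<close> matter.
\<close>

definition cinner :: "complex ^ 'n \<Rightarrow> complex ^ 'n \<Rightarrow> complex" where
  "cinner x y = (\<Sum>i\<in>UNIV. cnj (x $ i) * y $ i)"

definition conj_transpose :: "complex ^ 'n ^ 'm \<Rightarrow> complex ^ 'm ^ 'n" where
  "conj_transpose A = (\<chi> i j. cnj (A $ j $ i))"

definition hermitian :: "complex ^ 'n ^ 'n \<Rightarrow> bool" where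
  "hermitian A \<longleftrightarrow> conj_transpose A = A"

text \<open>For Hermitian \<open>A\<close> the number \<open>cinner x (A *v x)\<close> is real, so \<open>Re\<close> loses nothing.\<close>

definition pos_semidef :: "complex ^ 'n ^ 'n \<Rightarrow> bool" where
  "pos_semidef A \<longleftrightarrow> hermitian A \<and> (\<forall>x. 0 \<le> Re (cinner x (A *v x)))"

definition pos_def :: "complex ^ 'n ^ 'n \<Rightarrow> bool" where
  "pos_def A \<longleftrightarrow> hermitian A \<and> (\<forall>x. x \<noteq> 0 \<longrightarrow> 0 < Re (cinner x (A *v x)))"

definition density_operator :: "complex ^ 'n ^ 'n \<Rightarrow> bool" where
  "density_operator A \<longleftrightarrow> pos_semidef A \<and> trace A = 1"

text \<open>The orthogonal complement of the kernel; for Hermitian \<open>A\<close> this is also the range.\<close>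

definition supp :: "complex ^ 'n ^ 'n \<Rightarrow> (complex ^ 'n) set" where
  "supp A = {x. \<forall>y. A *v y = 0 \<longrightarrow> cinner y x = 0}"

definition independent_subspaces :: "nat \<Rightarrow> (nat \<Rightarrow> (complex ^ 'n) set) \<Rightarrow> bool" where
  "independent_subspaces m S \<longleftrightarrow>
     (\<forall>v. (\<forall>i\<in>{1..m}. v i \<in> S i) \<and> (\<Sum>i=1..m. v i) = 0 \<longrightarrow> (\<forall>i\<in>{1..m}. v i = 0))"

definition ensemble :: "nat \<Rightarrow> (nat \<Rightarrow> real) \<Rightarrow> (nat \<Rightarrow> complex ^ 'n ^ 'n) \<Rightarrow> bool" where
  "ensemble m p \<rho> \<longleftrightarrow>
     (\<forall>i\<in>{1..m}. p i > 0) \<and> (\<Sum>i=1..m. p i) = 1 \<and> (\<forall>i\<in>{1..m}. density_operator (\<rho> i))"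

text \<open>\<open>vec.span\<close> is the span over the complex numbers (\<open>span\<close> would be the real one).\<close>

definition lin_indep_ensemble ::
    "nat \<Rightarrow> (nat \<Rightarrow> real) \<Rightarrow> (nat \<Rightarrow> complex ^ 'n ^ 'n) \<Rightarrow> bool" where
  "lin_indep_ensemble m p \<rho> \<longleftrightarrow>
     ensemble m p \<rho> \<and>
     independent_subspaces m (\<lambda>i. supp (\<rho> i)) \<and>
     vec.span (\<Union>i\<in>{1..m}. supp (\<rho> i)) = UNIV"

definition povm :: "nat \<Rightarrow> (nat \<Rightarrow> complex ^ 'n ^ 'n) \<Rightarrow> bool" where
  "povm m E \<longleftrightarrow> (\<forall>i\<in>{1..m}. pos_semidef (E i)) \<and> (\<Sum>i=1..m. E i) = mat 1"

definition projective_measurement :: "nat \<Rightarrow> (nat \<Rightarrow> complex ^ 'n ^ 'n) \<Rightarrow> bool" where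
  "projective_measurement m E \<longleftrightarrow>
     povm m E \<and> (\<forall>i\<in>{1..m}. \<forall>j\<in>{1..m}. E i ** E j = (if i = j then E i else 0))"

text \<open>The trace of a product of two positive semidefinite matrices is real.\<close>

definition success_prob ::
    "nat \<Rightarrow> (nat \<Rightarrow> real) \<Rightarrow> (nat \<Rightarrow> complex ^ 'n ^ 'n) \<Rightarrow> (nat \<Rightarrow> complex ^ 'n ^ 'n) \<Rightarrow> real" where
  "success_prob m p \<rho> E = (\<Sum>i=1..m. p i * Re (trace (\<rho> i ** E i)))"

definition optimal_MED ::
    "nat \<Rightarrow> (nat \<Rightarrow> real) \<Rightarrow> (nat \<Rightarrow> complex ^ 'n ^ 'n) \<Rightarrow> (nat \<Rightarrow> complex ^ 'n ^ 'n) \<Rightarrow> bool" where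
  "optimal_MED m p \<rho> E \<longleftrightarrow>
     povm m E \<and> (\<forall>F. povm m F \<longrightarrow> success_prob m p \<rho> F \<le> success_prob m p \<rho> E)"

end

theory Submission
  imports Defs
begin

text \<open>
  Put \<open>A\<^sub>i = p\<^sub>i \<rho>\<^sub>i\<close> and \<open>Z = \<Sum>\<^sub>i A\<^sub>i E\<^sub>i\<close>. The measurement is optimal iff \<open>Z\<close> is Hermitian and
  \<open>Z \<ge> A\<^sub>i\<close> for all \<open>i\<close>. Necessity needs no convex duality: an explicit variation of \<open>E\<close> shows
  that the Hermitian part of \<open>Z\<close> dominates every \<open>A\<^sub>i\<close>, and complementary slackness then forces
  it to equal \<open>Z\<close>. When the supports span, \<open>Z \<ge> A\<^sub>i\<close> for all \<open>i\<close> gives \<open>Z > 0\<close>; when they are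
  also independent, comparing the components of \<open>Z E\<^sub>k x\<close> in the supports shows on the one hand
  that \<open>E\<close> is projective, and on the other hand that projectivity and \<open>Z > 0\<close> give \<open>Z \<ge> A\<^sub>i\<close>.
\<close>

section \<open>The Hermitian inner product\<close>

lemma cinner_add_right: "cinner x (y + z) = cinner x y + cinner x z"
  by (simp add: cinner_def distrib_left sum.distrib)

lemma cinner_add_left: "cinner (x + y) z = cinner x z + cinner y z"
  by (simp add: cinner_def distrib_right sum.distrib)

lemma cinner_diff_right: "cinner x (y - z) = cinner x y - cinner x z"
  by (simp add: cinner_def right_diff_distrib sum_subtractf)

lemma cinner_diff_left: "cinner (x - y) z = cinner x z - cinner y z"
  by (simp add: cinner_def left_diff_distrib sum_subtractf)

lemma cinner_smult_right: "cinner x (c *s y) = c * cinner x y"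
  by (simp add: cinner_def sum_distrib_left mult_ac)

lemma cinner_smult_left: "cinner (c *s x) y = cnj c * cinner x y"
  by (simp add: cinner_def sum_distrib_left mult_ac)

lemma cinner_scaleR_right: "cinner x (c *\<^sub>R y) = of_real c * cinner x y"
  by (simp add: cinner_def scaleR_conv_of_real[symmetric] scaleR_sum_right)

lemma cinner_0_right [simp]: "cinner x 0 = 0"
  by (simp add: cinner_def)

lemma cinner_sum_right: "cinner x (\<Sum>i\<in>I. f i) = (\<Sum>i\<in>I. cinner x (f i))"
  by (induction I rule: infinite_finite_induct) (simp_all add: cinner_add_right)

lemma cnj_cinner: "cnj (cinner x y) = cinner y x"
  by (simp add: cinner_def mult.commute)

lemma cinner_self: "cinner x x = of_real ((norm x)\<^sup>2)"
  by (simp add: cinner_def norm_vec_def L2_set_def complex_norm_square mult.commute sum_nonneg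
      del: of_real_power)

lemma cinner_self_eq_0_iff [simp]: "cinner x x = 0 \<longleftrightarrow> x = 0"
  by (simp add: cinner_self)

lemma cinner_conj_transpose: "cinner (conj_transpose A *v x) y = cinner x (A *v y)"
  unfolding cinner_def conj_transpose_def matrix_vector_mult_def
  by (simp add: sum_distrib_left sum_distrib_right, subst sum.swap) (simp add: mult_ac)

lemma hermitian_cinner: "hermitian A \<Longrightarrow> cinner (A *v x) y = cinner x (A *v y)"
  by (metis cinner_conj_transpose hermitian_def)

section \<open>Matrix algebra\<close>

lemma of_real_smult_eq_scaleR: "of_real c *s x = c *\<^sub>R x"
  for x :: "complex ^ 'n"
  by (simp add: vec_eq_iff scaleR_conv_of_real[symmetric])

lemma scaleR_matrix_vector_mult: "(c *\<^sub>R A) *v x = c *\<^sub>R (A *v x)"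
  for A :: "complex ^ 'n ^ 'm"
  by (simp add: vec_eq_iff matrix_vector_mult_def scaleR_sum_right)

lemma matrix_mult_diff_left: "(A - B) ** C = A ** C - B ** C"
  for A B :: "complex ^ 'n ^ 'm"
  by (simp add: vec_eq_iff matrix_matrix_mult_def left_diff_distrib sum_subtractf)

lemma matrix_mult_diff_right: "A ** (B - C) = A ** B - A ** C"
  for A :: "complex ^ 'n ^ 'm"
  by (simp add: vec_eq_iff matrix_matrix_mult_def right_diff_distrib sum_subtractf)

lemma matrix_mult_sum_right: "A ** (\<Sum>i\<in>I. F i) = (\<Sum>i\<in>I. A ** F i)"
  for A :: "complex ^ 'n ^ 'm"
  by (induction I rule: infinite_finite_induct) (simp_all add: matrix_add_ldistrib)

lemma matrix_mult_sum_left: "(\<Sum>i\<in>I. F i) ** A = (\<Sum>i\<in>I. F i ** A)"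
  for A :: "complex ^ 'n ^ 'm"
  by (induction I rule: infinite_finite_induct) 
     (simp_all add: vec_eq_iff matrix_matrix_mult_def distrib_right sum.distrib)

lemma matrix_sum_vector_mult: "(\<Sum>i\<in>I. F i) *v x = (\<Sum>i\<in>I. F i *v x)"
  for F :: "_ \<Rightarrow> complex ^ 'n ^ 'm"
  by (induction I rule: infinite_finite_induct) (simp_all add: matrix_vector_mult_add_rdistrib)

lemma trace_scaleR: "trace (c *\<^sub>R A) = of_real c * trace A"
  for A :: "complex ^ 'n ^ 'n"
  by (simp add: trace_def scaleR_conv_of_real[symmetric] scaleR_sum_right)

lemma trace_sum: "trace (\<Sum>i\<in>I. F i) = (\<Sum>i\<in>I. trace (F i))"
  for F :: "_ \<Rightarrow> complex ^ 'n ^ 'n"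
  unfolding trace_def by (simp add: sum.swap[of _ I])

lemma conj_transpose_add: "conj_transpose (A + B) = conj_transpose A + conj_transpose B"
  by (simp add: vec_eq_iff conj_transpose_def)

lemma conj_transpose_diff: "conj_transpose (A - B) = conj_transpose A - conj_transpose B"
  by (simp add: vec_eq_iff conj_transpose_def)

lemma conj_transpose_scaleR: "conj_transpose (c *\<^sub>R A) = c *\<^sub>R conj_transpose A"
  by (simp add: vec_eq_iff conj_transpose_def)

lemma conj_transpose_mult: "conj_transpose (A ** B) = conj_transpose B ** conj_transpose A"
  by (simp add: vec_eq_iff conj_transpose_def matrix_matrix_mult_def mult.commute)

lemma conj_transpose_conj_transpose [simp]: "conj_transpose (conj_transpose A) = A"
  by (simp add: vec_eq_iff conj_transpose_def)

lemma conj_transpose_mat_1 [simp]: "conj_transpose (mat 1) = mat 1"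
  by (simp add: vec_eq_iff conj_transpose_def mat_def)

lemma trace_conj_transpose: "trace (conj_transpose A) = cnj (trace A)"
  by (simp add: trace_def conj_transpose_def)

lemma cinner_conj_transpose_quadratic:
  "cinner x (conj_transpose A *v x) = cnj (cinner x (A *v x))"
  by (metis cinner_conj_transpose cnj_cinner)

text \<open>The rank-one operator attached to \<open>v\<close>. The vector need not have norm one,
  so nonnegative weights can be absorbed into it.\<close>

definition outer :: "complex ^ 'n \<Rightarrow> complex ^ 'n ^ 'n" where
  "outer v = (\<chi> i j. v $ i * cnj (v $ j))"

lemma outer_mult: "outer v *v x = cinner v x *s v"
  by (simp add: vec_eq_iff outer_def matrix_vector_mult_def cinner_def sum_distrib_left
      sum_distrib_right mult_ac)

lemma hermitian_outer: "conj_transpose (outer v) = outer v"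
  by (simp add: vec_eq_iff outer_def conj_transpose_def mult.commute)

lemma trace_mult_outer: "trace (A ** outer v) = cinner v (A *v v)"
  by (simp add: trace_def matrix_matrix_mult_def cinner_def matrix_vector_mult_def outer_def
      sum_distrib_left mult_ac)

lemma outer_scaleR: "outer (c *\<^sub>R v) = c\<^sup>2 *\<^sub>R outer v"
  by (simp add: vec_eq_iff outer_def power2_eq_square)

lemma mult_outer_eq_0: "A *v v = 0 \<Longrightarrow> A ** outer v = 0"
  by (simp add: matrix_eq matrix_vector_mul_assoc[symmetric] outer_mult vec.scale)

section \<open>Positive semidefinite matrices\<close>

lemma pos_semidef_add: "pos_semidef A \<Longrightarrow> pos_semidef B \<Longrightarrow> pos_semidef (A + B)"
  by (simp add: pos_semidef_def hermitian_def conj_transpose_add matrix_vector_mult_add_rdistrib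
      cinner_add_right)

lemma pos_semidef_scaleR: "pos_semidef A \<Longrightarrow> 0 \<le> c \<Longrightarrow> pos_semidef (c *\<^sub>R A)"
  by (simp add: pos_semidef_def hermitian_def conj_transpose_scaleR scaleR_matrix_vector_mult
      cinner_scaleR_right)

lemma pos_semidef_outer: "pos_semidef (outer v)"
proof -
  have "Re (cinner x (outer v *v x)) = (cmod (cinner v x))\<^sup>2" for x
    by (simp add: outer_mult cinner_smult_right cnj_cinner[of v x, symmetric]
        complex_norm_square[symmetric] del: of_real_power)
  then show ?thesis
    by (simp add: pos_semidef_def hermitian_def hermitian_outer)
qed

lemma pos_semidef_congruence:
  "pos_semidef A \<Longrightarrow> pos_semidef (conj_transpose C ** A ** C)"
  unfolding pos_semidef_def hermitian_def
  by (simp add: conj_transpose_mult matrix_mul_assoc matrix_vector_mul_assoc[symmetric])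
     (metis cinner_conj_transpose conj_transpose_conj_transpose)

lemma cinner_hermitian_real:
  assumes "hermitian A" shows "cinner x (A *v x) = of_real (Re (cinner x (A *v x)))"
  by (metis Reals_cnj_iff assms cnj_cinner hermitian_cinner of_real_Re)

text \<open>With \<open>y = A *v x\<close>, the quadratic form at \<open>y + t x\<close> has no term
  in the square of \<open>t\<close>. It is affine in real \<open>t\<close> with slope twice the
  squared norm of \<open>y\<close>, and stays nonnegative only if \<open>y = 0\<close>.\<close>

lemma pos_semidef_mult_eq_0:
  assumes A: "pos_semidef A" and x: "Re (cinner x (A *v x)) = 0"
  shows "A *v x = 0"
proof -
  define y where "y = A *v x"
  define a where "a = Re (cinner y (A *v y))"
  define b where "b = (norm y)\<^sup>2"
  have h: "hermitian A" using A by (simp add: pos_semidef_def)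
  have q: "0 \<le> a + 2 * t * b" for t :: real
  proof -
    have xy: "cinner x (A *v y) = of_real b"
      using hermitian_cinner[OF h, of x y] by (simp add: y_def[symmetric] cinner_self b_def)
    have yx: "cinner y (A *v x) = of_real b"
      by (simp add: y_def[symmetric] cinner_self b_def)
    have "0 \<le> Re (cinner (y + of_real t *s x) (A *v (y + of_real t *s x)))"
      using A by (simp add: pos_semidef_def)
    also have "\<dots> = a + 2 * t * b"
      using x by (simp add: matrix_vector_right_distrib cinner_add_left cinner_add_right vec.scale
          cinner_smult_left cinner_smult_right xy yx a_def)
    finally show ?thesis .
  qed
  have "b = 0"
  proof (rule ccontr)
    assume "b \<noteq> 0"
    then have "a + 2 * (- (a + 1) / (2 * b)) * b = -1" by (simp add: field_simps)
    with q[of "- (a + 1) / (2 * b)"] show False by linarith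
  qed
  then show ?thesis by (simp add: b_def y_def)
qed

text \<open>Subtracting the rank one matrix \<open>(A x) (A x)\<^sup>*\<close>, suitably scaled, keeps \<open>A\<close> positive
  semidefinite and puts \<open>x\<close> into its kernel.\<close>

lemma pos_semidef_induct [consumes 1, case_names zero add_outer]:
  fixes A :: "complex ^ 'n ^ 'n"
  assumes "pos_semidef A" and "Q 0"
    and step: "\<And>B v. pos_semidef B \<Longrightarrow> Q B \<Longrightarrow> Q (B + outer v)"
  shows "Q A"
  using assms(1)
\<comment> \<open>The induction is on the rank, written as the dimension of the space minus that of
  the kernel.\<close>
proof (induction "CARD('n) - vec.dim {x. A *v x = 0}" arbitrary: A rule: less_induct)
  case (less A)
  have h: "hermitian A" using less.prems by (simp add: pos_semidef_def)
  show ?case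
  proof (cases "A = 0")
    case True
    then show ?thesis using \<open>Q 0\<close> by simp
  next
    case False
    then obtain x where Ax: "A *v x \<noteq> 0" by (metis matrix_eq matrix_vector_mult_0)
    define s where "s = Re (cinner x (A *v x))"
    have "s > 0"
      using pos_semidef_mult_eq_0[OF less.prems] Ax less.prems
      by (metis less_eq_real_def pos_semidef_def s_def)
    have s: "cinner x (A *v x) = of_real s"
      using cinner_hermitian_real[OF h] by (simp add: s_def)
    \<comment> \<open>The scaling gives \<open>outer v *v x = A *v x\<close>, so that
      \<open>B *v x = 0\<close>.\<close>
    define v where "v = (1 / sqrt s) *\<^sub>R (A *v x)"
    define B where "B = A - outer v"
    have ov: "outer v *v y = (cinner x (A *v y) / of_real s) *s (A *v x)" for y
    proof -
      have "outer v = (1 / s) *\<^sub>R outer (A *v x)"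
        using \<open>s > 0\<close> by (simp add: v_def outer_scaleR power_divide)
      then show ?thesis
        by (simp add: scaleR_matrix_vector_mult outer_mult hermitian_cinner[OF h]
            of_real_smult_eq_scaleR[symmetric] divide_inverse mult.commute)
    qed
    have "pos_semidef B"
      unfolding pos_semidef_def
    proof (intro conjI allI)
      show "hermitian B"
        using h by (simp add: hermitian_def B_def conj_transpose_diff hermitian_outer)
      fix y
      \<comment> \<open>This \<open>t\<close> makes \<open>y - t *s x\<close> orthogonal to
        \<open>x\<close> for the form of \<open>A\<close>. Completing the square, the form of
        \<open>B\<close> at \<open>y\<close> is the form of \<open>A\<close> at that vector.\<close>
      define t where "t = cinner x (A *v y) / of_real s"
      have ts: "cinner x (A *v y) = t * of_real s" using \<open>s > 0\<close> by (simp add: t_def)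
      have yx: "cinner y (A *v x) = cnj t * of_real s"
        by (metis cnj_cinner complex_cnj_complex_of_real complex_cnj_mult h hermitian_cinner ts)
      have "0 \<le> Re (cinner (y - t *s x) (A *v (y - t *s x)))"
        using less.prems by (simp add: pos_semidef_def)
      also have "cinner (y - t *s x) (A *v (y - t *s x)) = cinner y (B *v y)"
        by (simp add: B_def matrix_vector_mult_diff_distrib matrix_vector_mult_diff_rdistrib ov
            cinner_diff_left cinner_diff_right vec.scale cinner_smult_left cinner_smult_right s yx
            t_def[symmetric])
           (simp add: ts)
      finally show "0 \<le> Re (cinner y (B *v y))" .
    qed
    moreover have "CARD('n) - vec.dim {x. B *v x = 0} < CARD('n) - vec.dim {x. A *v x = 0}"
    proof -
      let ?S = "{x. A *v x = 0}" and ?T = "{x. B *v x = 0}"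
      have "?S \<subseteq> ?T"
        by (auto simp: B_def matrix_vector_mult_diff_rdistrib ov)
      moreover have "x \<in> ?T" "x \<notin> ?S"
        using Ax \<open>s > 0\<close> by (auto simp: B_def matrix_vector_mult_diff_rdistrib ov s)
      moreover have "vec.subspace ?S" "vec.subspace ?T"
        by (auto simp: vec.subspace_def matrix_vector_right_distrib vec.scale)
      ultimately have "vec.dim ?S < vec.dim ?T"
        by (metis linorder_not_less vec.subspace_dim_equal)
      moreover have "vec.dim ?T \<le> CARD('n)"
        by (rule dim_subset_UNIV_cart_gen)
      ultimately show ?thesis by linarith
    qed
    ultimately have "Q (B + outer v)" using less.hyps step by blast
    then show ?thesis by (simp add: B_def)
  qed
qed

text \<open>Building \<open>B\<close> from rank-one terms \<open>outer v\<close>, each term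
  contributes a value \<open>cinner v (A *v v)\<close> of the form of \<open>A\<close>.\<close>

lemma trace_mult_pos_semidef_nonneg:
  assumes "pos_semidef A" "pos_semidef B"
  shows "0 \<le> Re (trace (A ** B))"
  using assms(2)
proof (induction rule: pos_semidef_induct)
  case zero
  then show ?case by (simp add: trace_def)
next
  case (add_outer B v)
  then show ?case
    using assms(1) by (simp add: matrix_add_ldistrib trace_add trace_mult_outer pos_semidef_def)
qed

text \<open>This is complementary slackness: when nonnegative rank-one contributions add up to zero,
  each of them vanishes, and then \<open>A\<close> annihilates each \<open>v\<close>.\<close>

lemma mult_pos_semidef_eq_0:
  assumes "pos_semidef A" "pos_semidef B" "Re (trace (A ** B)) = 0"
  shows "A ** B = 0"
  using assms(2,3)
proof (induction rule: pos_semidef_induct)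
  case zero
  then show ?case by simp
next
  case (add_outer B v)
  have "0 \<le> Re (trace (A ** B))"
    using assms(1) add_outer.hyps by (rule trace_mult_pos_semidef_nonneg)
  moreover have "0 \<le> Re (cinner v (A *v v))"
    using assms(1) by (simp add: pos_semidef_def)
  moreover have "Re (trace (A ** B)) + Re (cinner v (A *v v)) = 0"
    using add_outer.prems by (simp add: matrix_add_ldistrib trace_add trace_mult_outer)
  ultimately have "Re (trace (A ** B)) = 0" "Re (cinner v (A *v v)) = 0"
    by linarith+
  then show ?case
    using add_outer.IH pos_semidef_mult_eq_0[OF assms(1)]
    by (simp add: matrix_add_ldistrib mult_outer_eq_0)
qed

section \<open>Optimality conditions\<close>

text \<open>First variation of the success probability along
  \<open>E\<^sub>i \<mapsto> K E\<^sub>i K + \<delta>\<^sub>i\<^sub>j (1 - K K)\<close> with \<open>K = 1 - e v v\<^sup>*\<close>.\<close>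

lemma optimal_imp_quadratic_form_le:
  fixes m :: nat and A E :: "nat \<Rightarrow> complex ^ 'n ^ 'n"
  assumes A: "\<And>i. i \<in> {1..m} \<Longrightarrow> hermitian (A i)" and E: "povm m E"
    and opt: "\<And>F. povm m F \<Longrightarrow>
      (\<Sum>i=1..m. Re (trace (A i ** F i))) \<le> (\<Sum>i=1..m. Re (trace (A i ** E i)))"
    and j: "j \<in> {1..m}"
  shows "Re (cinner v (A j *v v)) \<le> Re (cinner v ((\<Sum>i=1..m. A i ** E i) *v v))"
proof (rule ccontr)
  define P where "P = outer v"
  define s where "s = (norm v)\<^sup>2"
  define a where "a = Re (cinner v (A j *v v))"
  define z where "z = Re (cinner v ((\<Sum>i=1..m. A i ** E i) *v v))"
  define C where "C = (\<Sum>i=1..m. Re (trace (A i ** P ** E i ** P)))"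
  define D where "D = C - s * a"
  have PP: "P ** P = s *\<^sub>R P"
    by (simp add: matrix_eq P_def matrix_vector_mul_assoc[symmetric] outer_mult vec.scale
        scaleR_matrix_vector_mult cinner_self s_def of_real_smult_eq_scaleR[symmetric]
        vector_smult_assoc mult.commute del: of_real_power)
  have hP: "conj_transpose P = P"
    by (simp add: P_def hermitian_outer)
  \<comment> \<open>The left-hand side is the gain in success probability of the varied measurement
    \<open>F\<close> over \<open>E\<close>. The bound on \<open>e * s\<close> keeps the coefficient
    \<open>r\<close> below nonnegative.\<close>
  have ineq: "e * (2 * (a - z) + e * D) \<le> 0" if e: "0 \<le> e" "e * s \<le> 2" for e
  proof -
    define K where "K = mat 1 - e *\<^sub>R P"
    \<comment> \<open>By \<open>PP\<close>, this is the number with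
      \<open>mat 1 - K ** K = r *\<^sub>R P\<close>.\<close>
    define r where "r = 2 * e - e\<^sup>2 * s"
    define F where "F i = K ** E i ** K + (if i = j then r *\<^sub>R P else 0)" for i
    have hK: "conj_transpose K = K"
      by (simp add: K_def conj_transpose_diff conj_transpose_scaleR hP)
    have "r = e * (2 - e * s)" by (simp add: r_def algebra_simps power2_eq_square)
    then have r: "r \<ge> 0" using e by simp
    have KK: "K ** K + r *\<^sub>R P = mat 1"
      by (simp add: K_def r_def matrix_mult_diff_left matrix_mult_diff_right matrix_scalar_ac
          scalar_matrix_assoc[symmetric] PP)
         (simp add: vec_eq_iff scaleR_conv_of_real algebra_simps power2_eq_square)
    have "pos_semidef (F i)" if "i \<in> {1..m}" for i
    proof -
      have "pos_semidef (E i)" using E that by (simp add: povm_def)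
      then have "pos_semidef (K ** E i ** K)"
        using pos_semidef_congruence[of "E i" K] by (simp add: hK)
      then show ?thesis
        using pos_semidef_scaleR[OF pos_semidef_outer r, of v]
        by (auto simp: F_def P_def pos_semidef_add)
    qed
    moreover have "(\<Sum>i=1..m. F i) = mat 1"
    proof -
      have "(\<Sum>i=1..m. F i) = K ** (\<Sum>i=1..m. E i) ** K + r *\<^sub>R P"
        using j by (simp add: F_def sum.distrib matrix_mult_sum_left matrix_mult_sum_right)
      then show ?thesis using E by (simp add: povm_def KK)
    qed
    ultimately have "povm m F" by (simp add: povm_def)
    have term_F: "Re (trace (A i ** F i)) = Re (trace (A i ** E i))
        - 2 * e * Re (cinner v ((A i ** E i) *v v)) + e\<^sup>2 * Re (trace (A i ** P ** E i ** P))
        + (if i = j then r * a else 0)" if i: "i \<in> {1..m}" for i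
    proof -
      \<comment> \<open>The two terms of first order in \<open>e\<close> have the same real trace:
        conjugate transposition followed by a cyclic shift turns one into the other.\<close>
      have "conj_transpose (A i ** E i ** P) = P ** (E i ** A i)"
        using A[OF i] E i
        by (simp add: conj_transpose_mult hP hermitian_def povm_def pos_semidef_def)
      then have "Re (trace (A i ** E i ** P)) = Re (trace (P ** (E i ** A i)))"
        by (metis complex_cnj(1) complex_surj trace_conj_transpose cnj.simps(1))
      also have "\<dots> = Re (trace (A i ** P ** E i))"
        by (metis matrix_mul_assoc trace_mul_sym)
      finally have sym: "Re (trace (A i ** P ** E i)) = Re (cinner v ((A i ** E i) *v v))"
        by (simp add: P_def trace_mult_outer)
      have "A i ** (K ** E i ** K) = A i ** E i - e *\<^sub>R (A i ** P ** E i)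
          - e *\<^sub>R (A i ** E i ** P) + e\<^sup>2 *\<^sub>R (A i ** P ** E i ** P)"
        by (simp add: K_def matrix_mult_diff_left matrix_mult_diff_right matrix_scalar_ac
            scalar_matrix_assoc[symmetric] matrix_mul_assoc)
           (simp add: algebra_simps power2_eq_square)
      then have "Re (trace (A i ** (K ** E i ** K))) = Re (trace (A i ** E i))
        - 2 * e * Re (cinner v ((A i ** E i) *v v)) + e\<^sup>2 * Re (trace (A i ** P ** E i ** P))"
        by (simp add: trace_add trace_sub trace_scaleR sym del: of_real_power)
           (simp add: P_def trace_mult_outer)
      moreover have "Re (trace (A i ** (r *\<^sub>R P))) = r * Re (cinner v (A i *v v))"
        by (simp add: matrix_scalar_ac scalar_matrix_assoc[symmetric] trace_scaleR P_def
            trace_mult_outer)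
      ultimately show ?thesis
        by (auto simp: F_def matrix_add_ldistrib trace_add trace_0[simplified] a_def)
    qed
    have "(\<Sum>i=1..m. Re (trace (A i ** F i))) = (\<Sum>i=1..m. Re (trace (A i ** E i)))
        - 2 * e * z + e\<^sup>2 * C + r * a"
      using j by (simp add: term_F sum.distrib sum_subtractf z_def C_def matrix_sum_vector_mult
          cinner_sum_right sum_distrib_left)
    with opt[OF \<open>povm m F\<close>] have "- 2 * e * z + e\<^sup>2 * C + r * a \<le> 0" by simp
    then show ?thesis by (simp add: r_def D_def algebra_simps power2_eq_square)
  qed
  assume "\<not> ?thesis"
  then have "a - z > 0" by (simp add: a_def z_def)
  \<comment> \<open>The first bound yields \<open>e * s \<le> 2\<close>. The second makes the
    second-order term too small to cancel the positive first-order gain.\<close>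
  define e where "e = min (1 / (s + 1)) ((a - z) / (\<bar>D\<bar> + 1))"
  have "s \<ge> 0" by (simp add: s_def)
  then have "e > 0" using \<open>a - z > 0\<close> by (simp add: e_def)
  have "e * s \<le> 1 / (s + 1) * s"
    using \<open>s \<ge> 0\<close> by (intro mult_right_mono) (simp_all add: e_def)
  also have "\<dots> \<le> 2" using \<open>s \<ge> 0\<close> by (simp add: field_simps)
  finally have "2 * (a - z) + e * D \<le> 0"
    using ineq[of e] \<open>e > 0\<close> by (simp add: mult_le_0_iff)
  moreover have "- (e * D) \<le> a - z"
  proof -
    have "- (e * D) \<le> e * \<bar>D\<bar>"
      using \<open>e > 0\<close> by (metis abs_ge_minus_self abs_mult abs_of_pos)
    also have "\<dots> \<le> (a - z) / (\<bar>D\<bar> + 1) * \<bar>D\<bar>"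
      by (intro mult_right_mono) (simp_all add: e_def)
    also have "\<dots> \<le> a - z"
      using \<open>a - z > 0\<close> by (simp add: field_simps)
    finally show ?thesis .
  qed
  ultimately have "a - z \<le> 0" by (simp add: algebra_simps)
  then show False using \<open>a - z > 0\<close> by simp
qed

text \<open>The Hermitian part \<open>Y\<close> of \<open>Z = \<Sum>\<^sub>i A\<^sub>i E\<^sub>i\<close> dominates every \<open>A\<^sub>i\<close>
  and \<open>\<Sum>\<^sub>i Tr ((Y - A\<^sub>i) E\<^sub>i) = 0\<close>. Hence \<open>Y E\<^sub>i = A\<^sub>i E\<^sub>i\<close> for all \<open>i\<close>; summing gives \<open>Y = Z\<close>.\<close>

lemma optimal_imp_dominating:
  fixes m :: nat and A E :: "nat \<Rightarrow> complex ^ 'n ^ 'n"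
  defines "Z \<equiv> \<Sum>i=1..m. A i ** E i"
  assumes A: "\<And>i. i \<in> {1..m} \<Longrightarrow> hermitian (A i)" and E: "povm m E"
    and opt: "\<And>F. povm m F \<Longrightarrow>
      (\<Sum>i=1..m. Re (trace (A i ** F i))) \<le> (\<Sum>i=1..m. Re (trace (A i ** E i)))"
  shows "hermitian Z" and "\<And>i. i \<in> {1..m} \<Longrightarrow> pos_semidef (Z - A i)"
    and "\<And>i. i \<in> {1..m} \<Longrightarrow> Z ** E i = A i ** E i"
proof -
  define Y where "Y = (1 / 2) *\<^sub>R (Z + conj_transpose Z)"
  have hY: "hermitian Y"
    by (simp add: hermitian_def Y_def conj_transpose_scaleR conj_transpose_add add.commute)
  have qY: "Re (cinner x (Y *v x)) = Re (cinner x (Z *v x))" for x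
    by (simp add: Y_def scaleR_matrix_vector_mult matrix_vector_mult_add_rdistrib cinner_add_right
        cinner_scaleR_right cinner_conj_transpose_quadratic)
  have psd: "pos_semidef (Y - A i)" if i: "i \<in> {1..m}" for i
    unfolding pos_semidef_def
  proof (intro conjI allI)
    show "hermitian (Y - A i)"
      using hY A[OF i] by (simp add: hermitian_def conj_transpose_diff)
    show "0 \<le> Re (cinner x ((Y - A i) *v x))" for x
      using optimal_imp_quadratic_form_le[OF A E opt i, of x]
      by (simp add: matrix_vector_mult_diff_rdistrib cinner_diff_right qY Z_def)
  qed
  have sE: "(\<Sum>i=1..m. E i) = mat 1" and pE: "\<And>i. i \<in> {1..m} \<Longrightarrow> pos_semidef (E i)"
    using E by (auto simp: povm_def)
  have "(\<Sum>i=1..m. (Y - A i) ** E i) = Y - Z"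
    by (simp only: matrix_mult_diff_left sum_subtractf matrix_mult_sum_right[symmetric] sE Z_def
        matrix_mul_rid)
  then have "(\<Sum>i=1..m. Re (trace ((Y - A i) ** E i))) = Re (trace (Y - Z))"
    by (metis (no_types) Re_sum trace_sum)
  \<comment> \<open>Passing to the Hermitian part preserves the real part of the trace.\<close>
  also have "\<dots> = 0"
    by (simp add: Y_def trace_sub trace_scaleR trace_add trace_conj_transpose)
  finally have *: "(\<Sum>i=1..m. Re (trace ((Y - A i) ** E i))) = 0" .
  have YE: "Y ** E i = A i ** E i" if i: "i \<in> {1..m}" for i
  proof -
    have "Re (trace ((Y - A i) ** E i)) = 0"
      using * trace_mult_pos_semidef_nonneg[OF psd pE] i
      by (subst (asm) sum_nonneg_eq_0_iff) auto
    from mult_pos_semidef_eq_0[OF psd[OF i] pE[OF i] this] show ?thesis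
      by (simp add: matrix_mult_diff_left)
  qed
  have "Y = Y ** (\<Sum>i=1..m. E i)" by (simp only: sE matrix_mul_rid)
  also have "\<dots> = Z" by (simp add: matrix_mult_sum_right YE Z_def)
  finally have "Y = Z" .
  then show "hermitian Z" "\<And>i. i \<in> {1..m} \<Longrightarrow> pos_semidef (Z - A i)"
    "\<And>i. i \<in> {1..m} \<Longrightarrow> Z ** E i = A i ** E i"
    using hY psd YE by auto
qed

text \<open>Replacing each \<open>A i\<close> by \<open>Z\<close> can only increase the value of
  \<open>F\<close>, and the resulting bound is the trace of \<open>Z\<close>, whatever
  \<open>F\<close> is.\<close>

lemma dominating_imp_optimal:
  fixes m :: nat and A E F :: "nat \<Rightarrow> complex ^ 'n ^ 'n"
  defines "Z \<equiv> \<Sum>i=1..m. A i ** E i"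
  assumes psd: "\<And>i. i \<in> {1..m} \<Longrightarrow> pos_semidef (Z - A i)" and F: "povm m F"
  shows "(\<Sum>i=1..m. Re (trace (A i ** F i))) \<le> (\<Sum>i=1..m. Re (trace (A i ** E i)))"
proof -
  have sF: "(\<Sum>i=1..m. F i) = mat 1" and pF: "\<And>i. i \<in> {1..m} \<Longrightarrow> pos_semidef (F i)"
    using F by (auto simp: povm_def)
  have "(\<Sum>i=1..m. Re (trace (A i ** F i))) \<le> (\<Sum>i=1..m. Re (trace (Z ** F i)))"
    using trace_mult_pos_semidef_nonneg[OF psd pF]
    by (intro sum_mono) (simp add: matrix_mult_diff_left trace_sub)
  also have "\<dots> = Re (trace (Z ** (\<Sum>i=1..m. F i)))"
    by (simp only: matrix_mult_sum_right trace_sum Re_sum)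
  also have "\<dots> = (\<Sum>i=1..m. Re (trace (A i ** E i)))"
    by (simp only: sF matrix_mul_rid Z_def trace_sum Re_sum)
  finally show ?thesis .
qed

section \<open>Linearly independent ensembles\<close>

lemma pos_def_mult_eq_0: "pos_def A \<Longrightarrow> A *v x = 0 \<Longrightarrow> x = 0"
  by (force simp: pos_def_def)

text \<open>\<open>A\<close> moves across \<open>cinner\<close> onto a kernel vector. This places
  the summands \<open>A i *v (E i *v x)\<close> of \<open>Z *v x\<close> in the independent
  supports.\<close>

lemma range_subset_supp: "hermitian A \<Longrightarrow> A *v x \<in> supp A"
  unfolding supp_def by (auto simp: hermitian_cinner[symmetric]) (simp add: cinner_def)

lemma supp_scaleR: "c \<noteq> 0 \<Longrightarrow> supp (c *\<^sub>R A) = supp A"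
  by (simp add: supp_def scaleR_matrix_vector_mult)

text \<open>Subtracting \<open>u\<close> from the component with index \<open>k\<close> leaves a
  family in the same subspaces with sum zero.\<close>

lemma independent_subspaces_unique:
  assumes ind: "independent_subspaces m S"
    and S: "\<And>i. i \<in> {1..m} \<Longrightarrow> vec.subspace (S i)"
    and v: "\<And>i. i \<in> {1..m} \<Longrightarrow> v i \<in> S i" "k \<in> {1..m}" "u \<in> S k" "(\<Sum>i=1..m. v i) = u"
    and i: "i \<in> {1..m}"
  shows "v i = (if i = k then u else 0)"
proof -
  define w where "w i = v i - (if i = k then u else 0)" for i
  have "\<forall>i\<in>{1..m}. w i \<in> S i"
    using v S by (auto simp: w_def intro!: vec.subspace_diff vec.subspace_0)
  moreover have "(\<Sum>i=1..m. w i) = 0"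
    using v by (simp add: w_def sum_subtractf)
  ultimately have "w i = 0"
    using ind i unfolding independent_subspaces_def by blast
  then show ?thesis by (simp add: w_def)
qed

lemma subspace_supp: "vec.subspace (supp A)"
  by (auto simp: vec.subspace_def supp_def cinner_add_right cinner_smult_right)

text \<open>If the form of \<open>Z\<close> is not positive at \<open>x\<close>, then the forms of
  all \<open>A i\<close>, squeezed between zero and it, vanish there. So every \<open>A i\<close>
  annihilates \<open>x\<close>, which is then orthogonal to all supports, to their span and hence to
  itself.\<close>

lemma dominating_imp_pos_def:
  fixes Z :: "complex ^ 'n ^ 'n"
  assumes herm: "hermitian Z" and dom: "\<And>i. i \<in> {1..m} \<Longrightarrow> pos_semidef (Z - A i)"
    and A: "\<And>i. i \<in> {1..m} \<Longrightarrow> pos_semidef (A i)"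
    and spanning: "vec.span (\<Union>i\<in>{1..m}. supp (A i)) = UNIV"
  shows "pos_def Z"
  unfolding pos_def_def
proof (intro conjI allI impI)
  show "hermitian Z" by fact
  fix x :: "complex ^ 'n" assume "x \<noteq> 0"
  have le: "Re (cinner x (A i *v x)) \<le> Re (cinner x (Z *v x))" if "i \<in> {1..m}" for i
    using dom[OF that]
    by (simp add: pos_semidef_def matrix_vector_mult_diff_rdistrib cinner_diff_right)
  have ge: "0 \<le> Re (cinner x (A i *v x))" if "i \<in> {1..m}" for i
    using A[OF that] by (simp add: pos_semidef_def)
  show "0 < Re (cinner x (Z *v x))"
  proof (rule ccontr)
    assume "\<not> ?thesis"
    then have "A i *v x = 0" if "i \<in> {1..m}" for i
      using le[OF that] ge[OF that] by (intro pos_semidef_mult_eq_0[OF A[OF that]]) simp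
    then have "(\<Union>i\<in>{1..m}. supp (A i)) \<subseteq> {y. cinner x y = 0}"
      by (auto simp: supp_def)
    moreover have "vec.subspace {y. cinner x y = 0}"
      by (simp add: vec.subspace_def cinner_add_right cinner_smult_right)
    ultimately have "vec.span (\<Union>i\<in>{1..m}. supp (A i)) \<subseteq> {y. cinner x y = 0}"
      by (rule vec.span_minimal)
    then have "cinner x x = 0" unfolding spanning by blast
    then show False using \<open>x \<noteq> 0\<close> by simp
  qed
qed

text \<open>Both \<open>A\<^sub>k E\<^sub>k x\<close> and \<open>\<Sum>\<^sub>i A\<^sub>i E\<^sub>i E\<^sub>k x\<close> equal \<open>Z E\<^sub>k x\<close>, so by independence
  \<open>Z E\<^sub>i E\<^sub>k x = A\<^sub>i E\<^sub>i E\<^sub>k x = 0\<close> for \<open>i \<noteq> k\<close>.\<close>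

lemma dominating_imp_projective:
  fixes m :: nat and A E :: "nat \<Rightarrow> complex ^ 'n ^ 'n"
  defines "Z \<equiv> \<Sum>i=1..m. A i ** E i"
  assumes A: "\<And>i. i \<in> {1..m} \<Longrightarrow> hermitian (A i)" and E: "povm m E"
    and ind: "independent_subspaces m (\<lambda>i. supp (A i))"
    and Z: "pos_def Z" and ZE: "\<And>i. i \<in> {1..m} \<Longrightarrow> Z ** E i = A i ** E i"
  shows "projective_measurement m E"
proof -
  have orth: "E i ** E k = 0" if i: "i \<in> {1..m}" and k: "k \<in> {1..m}" and "i \<noteq> k" for i k
  proof -
    have "E i *v (E k *v x) = 0" for x
    proof (rule pos_def_mult_eq_0[OF Z])
      have "(\<Sum>i=1..m. A i *v (E i *v (E k *v x))) = A k *v (E k *v x)"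
        using ZE[OF k]
        by (simp add: Z_def matrix_sum_vector_mult[symmetric] matrix_vector_mul_assoc)
           (simp add: matrix_mul_assoc matrix_mult_sum_left)
      from independent_subspaces_unique[OF ind _ _ k _ this i]
      have "A i *v (E i *v (E k *v x)) = 0"
        using A k \<open>i \<noteq> k\<close> by (simp add: subspace_supp range_subset_supp)
      then show "Z *v (E i *v (E k *v x)) = 0"
        by (simp add: matrix_vector_mul_assoc matrix_mul_assoc ZE[OF i])
    qed
    then show ?thesis by (simp add: matrix_eq matrix_vector_mul_assoc[symmetric])
  qed
  have idem: "E k ** E k = E k" if k: "k \<in> {1..m}" for k
  proof -
    have "E k = (\<Sum>i=1..m. E i) ** E k" using E by (simp add: povm_def)
    also have "\<dots> = (\<Sum>i=1..m. if i = k then E k ** E k else 0)"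
      unfolding matrix_mult_sum_left using orth k by (intro sum.cong) auto
    finally show ?thesis using k by simp
  qed
  show ?thesis using E orth idem by (auto simp: projective_measurement_def)
qed

text \<open>Writing \<open>A\<^sub>k x = Z w = \<Sum>\<^sub>i A\<^sub>i E\<^sub>i w\<close>, independence gives \<open>A\<^sub>k x = A\<^sub>k u\<close> for
  \<open>u = E\<^sub>k w\<close>. On the range of \<open>E\<^sub>k\<close> the matrices \<open>Z\<close> and \<open>A\<^sub>k\<close> agree, and the cross terms of
  \<open>Z\<close> between \<open>u\<close> and the kernel vector \<open>x - u\<close> of \<open>A\<^sub>k\<close> vanish.\<close>

lemma projective_imp_dominating:
  fixes m :: nat and A E :: "nat \<Rightarrow> complex ^ 'n ^ 'n"
  defines "Z \<equiv> \<Sum>i=1..m. A i ** E i"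
  assumes A: "\<And>i. i \<in> {1..m} \<Longrightarrow> hermitian (A i)"
    and ind: "independent_subspaces m (\<lambda>i. supp (A i))"
    and Z: "pos_def Z" and E: "projective_measurement m E" and k: "k \<in> {1..m}"
  shows "pos_semidef (Z - A k)"
  unfolding pos_semidef_def
proof (intro conjI allI)
  have hZ: "hermitian Z" using Z by (simp add: pos_def_def)
  then show "hermitian (Z - A k)" using A[OF k] by (simp add: hermitian_def conj_transpose_diff)
  fix x
  have "inj ((*v) Z)"
    using pos_def_mult_eq_0[OF Z]
    by (auto simp: inj_on_def) (metis eq_iff_diff_eq_0 matrix_vector_mult_diff_distrib)
  then have "surj ((*v) Z)"
    using vec.linear_inj_imp_surj matrix_vector_mul_linear_gen by blast
  then obtain w where w: "A k *v x = Z *v w" by (metis surjD)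
  define u where "u = E k *v w"
  define n where "n = x - u"
  have "(\<Sum>i=1..m. A i *v (E i *v w)) = A k *v x"
    by (simp add: w Z_def matrix_sum_vector_mult matrix_vector_mul_assoc)
  from independent_subspaces_unique[OF ind _ _ k _ this k]
  have Au: "A k *v u = A k *v x"
    using A k by (simp add: subspace_supp range_subset_supp u_def)
  have "Z ** E k = (\<Sum>i=1..m. if i = k then A k ** E k else 0)"
    using E k unfolding Z_def matrix_mult_sum_left
    by (intro sum.cong)
       (auto simp: projective_measurement_def matrix_mul_assoc[symmetric])
  then have "Z ** E k = A k ** E k" using k by simp
  then have Zu: "Z *v u = A k *v u" by (simp add: u_def matrix_vector_mul_assoc)
  have An: "A k *v n = 0" by (simp add: n_def matrix_vector_mult_diff_distrib Au)
  have nZu: "cinner n (Z *v u) = 0" using hermitian_cinner[OF A[OF k], of n u]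
    by (simp add: Zu An) (simp add: cinner_def)
  have uZn: "cinner u (Z *v n) = 0"
    using nZu hermitian_cinner[OF hZ] by (metis cnj_cinner complex_cnj_zero)
  have "cinner x ((Z - A k) *v x) = cinner (u + n) ((Z - A k) *v (u + n))"
    by (simp add: n_def)
  \<comment> \<open>\<open>Z - A k\<close> annihilates \<open>u\<close> and agrees with
    \<open>Z\<close> on \<open>n\<close>; the cross term left over is \<open>uZn\<close>.\<close>
  also have "\<dots> = cinner n (Z *v n)"
    by (simp add: matrix_vector_mult_diff_rdistrib matrix_vector_right_distrib cinner_add_left
        cinner_add_right Zu An uZn)
  finally show "0 \<le> Re (cinner x ((Z - A k) *v x))"
    using Z by (cases "n = 0") (auto simp: pos_def_def less_imp_le)
qed

theorem corollary3p1p3: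
  fixes m :: nat
    and p :: "nat \<Rightarrow> real"
    and \<rho> E :: "nat \<Rightarrow> complex ^ 'n ^ 'n"
  assumes "lin_indep_ensemble m p \<rho>"
    and "povm m E"
  shows "optimal_MED m p \<rho> E \<longleftrightarrow>
    projective_measurement m E \<and> pos_def (\<Sum>i=1..m. p i *\<^sub>R (\<rho> i ** E i))"
proof -
  \<comment> \<open>The priors are absorbed into the operators. Being positive, they change neither
    semidefiniteness nor the supports.\<close>
  define A where "A i = p i *\<^sub>R \<rho> i" for i
  define Z where "Z = (\<Sum>i=1..m. A i ** E i)"
  have p: "p i > 0" and rho: "pos_semidef (\<rho> i)" if "i \<in> {1..m}" for i
    using assms(1) that by (auto simp: lin_indep_ensemble_def ensemble_def density_operator_def)
  then have A: "pos_semidef (A i)" "hermitian (A i)" if "i \<in> {1..m}" for i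
    using that pos_semidef_scaleR[of "\<rho> i" "p i"] by (auto simp: A_def pos_semidef_def less_imp_le)
  have supp: "supp (A i) = supp (\<rho> i)" if "i \<in> {1..m}" for i
    using p[OF that] by (simp add: A_def supp_scaleR)
  have ind: "independent_subspaces m (\<lambda>i. supp (A i))"
    using assms(1) by (simp add: lin_indep_ensemble_def independent_subspaces_def supp)
  have spanning: "vec.span (\<Union>i\<in>{1..m}. supp (A i)) = UNIV"
    using assms(1) by (simp add: lin_indep_ensemble_def supp)
  have success: "success_prob m p \<rho> F = (\<Sum>i=1..m. Re (trace (A i ** F i)))" for F
    by (simp add: success_prob_def A_def scalar_matrix_assoc[symmetric] trace_scaleR)
  have Z: "(\<Sum>i=1..m. p i *\<^sub>R (\<rho> i ** E i)) = Z"
    by (simp add: Z_def A_def scalar_matrix_assoc)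
  show ?thesis
    unfolding Z
  proof
    assume "optimal_MED m p \<rho> E"
    then have opt: "(\<Sum>i=1..m. Re (trace (A i ** F i))) \<le> (\<Sum>i=1..m. Re (trace (A i ** E i)))"
      if "povm m F" for F
      using that by (simp add: optimal_MED_def success)
    note dom = optimal_imp_dominating[OF A(2) assms(2) opt, folded Z_def]
    have "pos_def Z"
      using dom(1,2) A(1) spanning by (rule dominating_imp_pos_def)
    moreover from this have "projective_measurement m E"
      using dominating_imp_projective[OF A(2) assms(2) ind] dom(3) by (simp add: Z_def)
    ultimately show "projective_measurement m E \<and> pos_def Z" by simp
  next
    assume "projective_measurement m E \<and> pos_def Z"
    then have "pos_semidef (Z - A i)" if "i \<in> {1..m}" for i
      using projective_imp_dominating[OF A(2) ind _ _ that] by (simp add: Z_def)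
    then show "optimal_MED m p \<rho> E"
      using dominating_imp_optimal[of m A E] assms(2)
      by (simp add: optimal_MED_def success Z_def del: One_nat_def)
  qed
qed

end
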